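(* Let $n,l,T\ge1$ and $d_0,\dots,d_T,d'_0,\dots,d'_{T-1}\ge1$ be integers, and for $t=0,\dots,T-1$ let $M_t:\mathbb{R}^{d_t}\times\mathbb{R}^{d_t}\times\mathbb{R}^l\to\mathbb{R}^{d'_t}$ and $U_t:\mathbb{R}^{d_t}\times\mathbb{R}^{d'_t}\to\mathbb{R}^{d_{t+1}}$ be continuous. Consider the message passing network with $T$ layers defined by these functions, mapping $(A,E,H^0)$ with $A\in\{0,1\}^{n\times n}$, $E\in\mathbb{R}^{n\times n\times l}$, $H^0\in\mathbb{R}^{n\times d_0}$ to $H^T\in\mathbb{R}^{n\times d_T}$. Then for every compact set $K\subset\mathbb{R}^{n\times d_0}\times\mathbb{R}^{n\times n\times l}$ and every $\varepsilon>0$ there exists an order-2 equivariant graph network $F:\mathbb{R}^{n\times n\times(1+l+d_0)}\to\mathbb{R}^{n\times n\times(1+l+d_T)}$ such that for all $(H^0,E)\in K$ and all $A\in\{0,1\}^{n\times n}$, $$\big\|F(\mathcal{Y}(A,E,H^0))-\mathcal{Y}(A,E,H^T)\big\|_\infty\le\varepsilon .$$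
   Context: Message passing network: given an adjacency matrix $A=(a_{uv})\in\{0,1\}^{n\times n}$, edge features $E=(e_{uv})\in\mathbb{R}^{n\times n\times l}$ and initial node features $H^0=(h^0_u)\in\mathbb{R}^{n\times d_0}$, put $N(u)=\{v\in[n]:a_{uv}=1\}$, $[n]=\{1,\dots,n\}$, and define for $t=0,\dots,T-1$ and $u\in[n]$ $$m^{t+1}_u=\sum_{v\in N(u)}M_t(h^t_u,h^t_v,e_{uv}),\qquad h^{t+1}_u=U_t(h^t_u,m^{t+1}_u),\qquad H^{t+1}=(h^{t+1}_u)_u.$$ Encoding: for $H=(h_u)\in\mathbb{R}^{n\times c}$, $\mathcal{Y}(A,E,H)\in\mathbb{R}^{n\times n\times(1+l+c)}$ is the tensor whose $(u,v)$ feature vector is $[a_{uv},e_{uv},\delta_{uv}h_u]$ ($\delta_{uv}$ the Kronecker delta). Model: an order-2 equivariant linear layer is an affine map $L:\mathbb{R}^{n\times n\times c}\to\mathbb{R}^{n\times n\times c'}$ with $L(P\star X)=P\star L(X)$ for all $X$ and all $n\times n$ permutation matrices $P$, where, for $p$ the permutation of $P$, the $(p(i),p(j),s)$-th entry of $P\star X$ equals the $(i,j,s)$-th entry of $X$. An order-2 equivariant graph network is a composition $L_r\circ\sigma\circ L_{r-1}\circ\cdots\circ\sigma\circ L_1$ of such layers (any number $r\geq 1$ of layers, any numbers of intermediate feature channels), where $\sigma$ is the entrywise ReLU $\sigma(x)=\max(x,0)$. $\|\cdot\|_\infty$ is the maximum absolute entry. *)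

theory Defs
  imports "HOL-Analysis.Analysis"
begin

text \<open>
  The dimensions of the feature spaces vary with the layer, so feature vectors in
  \<open>\<real>\<^sup>d\<close> are elements of \<^term>\<open>topspace (Euclidean_space d)\<close>: sequences
  \<open>x :: nat \<Rightarrow> real\<close> with \<open>x i = 0\<close> for \<open>i \<ge> d\<close> (coordinates are counted from 0).
  The number of nodes is fixed, so nodes are the elements of a finite type \<open>'n\<close>.
  Sets of node and edge features carry the product topology of the function type,
  which on the sets below is the usual topology of the finite-dimensional space.
\<close>

type_synonym vec = "nat \<Rightarrow> real"
type_synonym 'n tensor = "'n \<Rightarrow> 'n \<Rightarrow> vec"

definition vecs :: "nat \<Rightarrow> vec set" where
  "vecs d = topspace (Euclidean_space d)"

definition node_features :: "nat \<Rightarrow> ('n \<Rightarrow> vec) set" where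
  "node_features d = {H. \<forall>u. H u \<in> vecs d}"

definition tensors :: "nat \<Rightarrow> 'n tensor set" where
  "tensors c = {X. \<forall>u v. X u v \<in> vecs c}"

definition adjacency_matrix :: "('n \<Rightarrow> 'n \<Rightarrow> real) \<Rightarrow> bool" where
  "adjacency_matrix A \<longleftrightarrow> (\<forall>u v. A u v \<in> {0, 1})"


subsection \<open>Message passing networks\<close>

definition neighbours :: "('n \<Rightarrow> 'n \<Rightarrow> real) \<Rightarrow> 'n \<Rightarrow> 'n set" where
  "neighbours A u = {v. A u v = 1}"

primrec mpnn ::
  "(nat \<Rightarrow> vec \<Rightarrow> vec \<Rightarrow> vec \<Rightarrow> vec) \<Rightarrow> (nat \<Rightarrow> vec \<Rightarrow> vec \<Rightarrow> vec) \<Rightarrow>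
   ('n \<Rightarrow> 'n \<Rightarrow> real) \<Rightarrow> 'n tensor \<Rightarrow> ('n \<Rightarrow> vec) \<Rightarrow> nat \<Rightarrow> 'n \<Rightarrow> vec"
where
  "mpnn M U A E H0 0 = H0"
| "mpnn M U A E H0 (Suc t) =
     (let H = mpnn M U A E H0 t;
          m = (\<lambda>u s. \<Sum>v\<in>neighbours A u. M t (H u) (H v) (E u v) s)
      in (\<lambda>u. U t (H u) (m u)))"


subsection \<open>Tensor encoding\<close>

text \<open>
  Channel 0 holds \<open>A\<close>, channels \<open>1, \<dots>, l\<close> hold \<open>E\<close>, the remaining ones hold \<open>H\<close> on the
  diagonal. For \<open>H \<in> node_features c\<close> the result lies in \<open>tensors (1 + l + c)\<close>.
\<close>

definition encoding ::
  "nat \<Rightarrow> ('n \<Rightarrow> 'n \<Rightarrow> real) \<Rightarrow> 'n tensor \<Rightarrow> ('n \<Rightarrow> vec) \<Rightarrow> 'n tensor"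
where
  "encoding l A E H = (\<lambda>u v s.
     if s = 0 then A u v
     else if s < 1 + l then E u v (s - 1)
     else if u = v then H u (s - (1 + l)) else 0)"


subsection \<open>Equivariant graph networks\<close>

text \<open>
  Maps between tensor spaces are only constrained on the carrier sets \<open>tensors c\<close>.
  In \<open>perm_act p\<close> the bijection \<open>p\<close> stands for its permutation matrix, so that
  \<open>perm_act p X (p i) (p j) s = X i j s\<close>.
\<close>

definition perm_act :: "('n \<Rightarrow> 'n) \<Rightarrow> 'n tensor \<Rightarrow> 'n tensor" where
  "perm_act p X = (\<lambda>i j s. X (inv p i) (inv p j) s)"

definition linear_map :: "nat \<Rightarrow> nat \<Rightarrow> ('n tensor \<Rightarrow> 'n tensor) \<Rightarrow> bool" where
  "linear_map c c' W \<longleftrightarrow>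
     (\<forall>X\<in>tensors c. W X \<in> tensors c') \<and>
     (\<forall>X\<in>tensors c. \<forall>Y\<in>tensors c.
        W (\<lambda>i j s. X i j s + Y i j s) = (\<lambda>i j s. W X i j s + W Y i j s)) \<and>
     (\<forall>a. \<forall>X\<in>tensors c. W (\<lambda>i j s. a * X i j s) = (\<lambda>i j s. a * W X i j s))"

definition affine_map :: "nat \<Rightarrow> nat \<Rightarrow> ('n tensor \<Rightarrow> 'n tensor) \<Rightarrow> bool" where
  "affine_map c c' L \<longleftrightarrow>
     (\<exists>W B. linear_map c c' W \<and> B \<in> tensors c' \<and>
        (\<forall>X\<in>tensors c. L X = (\<lambda>i j s. W X i j s + B i j s)))"

definition equivariant_layer :: "nat \<Rightarrow> nat \<Rightarrow> ('n tensor \<Rightarrow> 'n tensor) \<Rightarrow> bool" where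
  "equivariant_layer c c' L \<longleftrightarrow>
     affine_map c c' L \<and>
     (\<forall>X\<in>tensors c. \<forall>p. bij p \<longrightarrow> L (perm_act p X) = perm_act p (L X))"

definition relu :: "'n tensor \<Rightarrow> 'n tensor" where
  "relu X = (\<lambda>i j s. max (X i j s) 0)"

inductive equivariant_network :: "nat \<Rightarrow> nat \<Rightarrow> ('n tensor \<Rightarrow> 'n tensor) \<Rightarrow> bool" where
  layer: "equivariant_layer c c' L \<Longrightarrow> equivariant_network c c' L"
| comp: "equivariant_network c c' F \<Longrightarrow> c' \<ge> 1 \<Longrightarrow> equivariant_layer c' c'' L \<Longrightarrow>
     equivariant_network c c'' (L \<circ> relu \<circ> F)"

definition max_norm :: "nat \<Rightarrow> 'n::finite tensor \<Rightarrow> real" where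
  "max_norm c X = Max {\<bar>X i j s\<bar> | i j s. s < c}"

end

theory Submission
  imports Defs
begin

text \<open>
  No error is propagated through the message passing layers. Instead, call a matrix-valued
  function of the input approximable if it is bounded and a uniform limit of single-channel
  network outputs. These functions are closed under linear combinations, equivariant linear
  operators on matrices (row sums, restriction to and broadcasting of the diagonal), entrywise
  ReLU and uniform limits. ReLU gives the parabola \<open>x (1 - x)\<close> as a uniform limit of iterated
  tent maps, hence squares and products, and then Stone--Weierstrass gives closure under entrywise
  application of arbitrary continuous functions. Message passing is composed of exactly these
  operations, so by induction all features \<open>H\<^sup>t\<close> are approximable.
\<close>

subsection \<open>Networks\<close>

text \<open>A layerwise argument would have to control \<open>M t\<close> and \<open>U t\<close>
  near the features that occur, because a network only delivers perturbed arguments. Closure under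
  uniform limits avoids this: the exact features are themselves approximable, and
  \<open>M t\<close>, \<open>U t\<close> are applied to them alone. Two obstacles shape the rest. A
  ReLU network is piecewise affine, so the products needed by Stone-Weierstrass, and for masking
  messages with the entries of \<open>A\<close>, arise only as limits. And the networks to be
  combined have depths that depend on their accuracies, so running them side by side needs a
  construction of its own. Equivariance prevents separating a graph from a relabelled copy at
  corresponding entries. Stone-Weierstrass is therefore applied on a compact box containing the
  values of the arguments of \<open>M t\<close> or \<open>U t\<close>, where coordinates separate
  points, and not on the set of inputs.\<close>

lemma mem_vecs_iff: "x \<in> vecs d \<longleftrightarrow> (\<forall>s\<ge>d. x s = 0)"
  by (simp add: vecs_def topspace_Euclidean_space)

lemma mem_tensors_iff: "X \<in> tensors c \<longleftrightarrow> (\<forall>u v s. c \<le> s \<longrightarrow> X u v s = 0)"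
  by (auto simp: tensors_def mem_vecs_iff)

lemma perm_act_in_tensors: "X \<in> tensors c \<Longrightarrow> perm_act p X \<in> tensors c"
  by (simp add: mem_tensors_iff perm_act_def)

lemma relu_in_tensors: "X \<in> tensors c \<Longrightarrow> relu X \<in> tensors c"
  by (simp add: mem_tensors_iff relu_def)

text \<open>The channel axis is a sequence padded with zeros, so a direct sum of tensor spaces is
  index arithmetic: \<open>hcat\<close> forms the pair, and \<open>trunc\<close> and
  \<open>shift\<close> below are its two projections.\<close>

definition hcat :: "nat \<Rightarrow> 'n tensor \<Rightarrow> 'n tensor \<Rightarrow> 'n tensor" where
  "hcat c X Y = (\<lambda>i j s. if s < c then X i j s else Y i j (s - c))"

definition trunc :: "nat \<Rightarrow> 'n tensor \<Rightarrow> 'n tensor" where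
  "trunc c X = (\<lambda>i j s. if s < c then X i j s else 0)"

definition shift :: "nat \<Rightarrow> 'n tensor \<Rightarrow> 'n tensor" where
  "shift c X = (\<lambda>i j s. X i j (c + s))"

lemma hcat_in_tensors: "Y \<in> tensors k \<Longrightarrow> hcat c X Y \<in> tensors (c + k)"
  by (simp add: mem_tensors_iff hcat_def)

lemma trunc_in_tensors: "trunc c X \<in> tensors c"
  by (simp add: mem_tensors_iff trunc_def)

lemma shift_in_tensors: "X \<in> tensors (c + k) \<Longrightarrow> shift c X \<in> tensors k"
  by (simp add: mem_tensors_iff shift_def)

lemma trunc_hcat: "X \<in> tensors c \<Longrightarrow> trunc c (hcat c X Y) = X"
  by (auto simp: fun_eq_iff mem_tensors_iff trunc_def hcat_def)

lemma shift_hcat: "shift c (hcat c X Y) = Y"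
  by (simp add: fun_eq_iff shift_def hcat_def)

section \<open>Algebra of affine equivariant layers\<close>

lemma affine_mapE:
  assumes "affine_map c c' L"
  obtains W B where "\<And>X. X \<in> tensors c \<Longrightarrow> W X \<in> tensors c'" "B \<in> tensors c'"
    "\<And>X Y. X \<in> tensors c \<Longrightarrow> Y \<in> tensors c \<Longrightarrow>
       W (\<lambda>i j s. X i j s + Y i j s) = (\<lambda>i j s. W X i j s + W Y i j s)"
    "\<And>a X. X \<in> tensors c \<Longrightarrow> W (\<lambda>i j s. a * X i j s) = (\<lambda>i j s. a * W X i j s)"
    "\<And>X. X \<in> tensors c \<Longrightarrow> L X = (\<lambda>i j s. W X i j s + B i j s)"
  using assms unfolding affine_map_def linear_map_def by blast

lemma affine_mapI:
  assumes "\<And>X. X \<in> tensors c \<Longrightarrow> W X \<in> tensors c'" "B \<in> tensors c'"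
    "\<And>X Y. X \<in> tensors c \<Longrightarrow> Y \<in> tensors c \<Longrightarrow>
       W (\<lambda>i j s. X i j s + Y i j s) = (\<lambda>i j s. W X i j s + W Y i j s)"
    "\<And>a X. X \<in> tensors c \<Longrightarrow> W (\<lambda>i j s. a * X i j s) = (\<lambda>i j s. a * W X i j s)"
    "\<And>X. X \<in> tensors c \<Longrightarrow> L X = (\<lambda>i j s. W X i j s + B i j s)"
  shows "affine_map c c' L"
  unfolding affine_map_def linear_map_def
  by (rule exI[of _ W], rule exI[of _ B]) (use assms in blast)

lemma affine_map_in_tensors:
  "affine_map c c' L \<Longrightarrow> X \<in> tensors c \<Longrightarrow> L X \<in> tensors c'"
  by (erule affine_mapE) (simp add: mem_tensors_iff)

lemma equivariant_layer_in_tensors: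
  "equivariant_layer c c' L \<Longrightarrow> X \<in> tensors c \<Longrightarrow> L X \<in> tensors c'"
  unfolding equivariant_layer_def by (blast intro: affine_map_in_tensors)

text \<open>L' (W X + B) = W' (W X) + (W' B + B'). Networks have a ReLU between any two layers;
  merging layers is what lets a layer follow a network without one.\<close>

lemma equivariant_layer_comp:
  assumes L: "equivariant_layer c c' L" and L': "equivariant_layer c' c'' L'"
  shows "equivariant_layer c c'' (L' \<circ> L)"
  unfolding equivariant_layer_def
proof (intro conjI ballI allI impI)
  obtain W B where 1: "\<And>X. X \<in> tensors c \<Longrightarrow> W X \<in> tensors c'" "B \<in> tensors c'"
    "\<And>X Y. X \<in> tensors c \<Longrightarrow> Y \<in> tensors c \<Longrightarrow>
       W (\<lambda>i j s. X i j s + Y i j s) = (\<lambda>i j s. W X i j s + W Y i j s)"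
    "\<And>a X. X \<in> tensors c \<Longrightarrow> W (\<lambda>i j s. a * X i j s) = (\<lambda>i j s. a * W X i j s)"
    "\<And>X. X \<in> tensors c \<Longrightarrow> L X = (\<lambda>i j s. W X i j s + B i j s)"
    using L affine_mapE unfolding equivariant_layer_def by blast
  obtain W' B' where 2: "\<And>X. X \<in> tensors c' \<Longrightarrow> W' X \<in> tensors c''" "B' \<in> tensors c''"
    "\<And>X Y. X \<in> tensors c' \<Longrightarrow> Y \<in> tensors c' \<Longrightarrow>
       W' (\<lambda>i j s. X i j s + Y i j s) = (\<lambda>i j s. W' X i j s + W' Y i j s)"
    "\<And>a X. X \<in> tensors c' \<Longrightarrow> W' (\<lambda>i j s. a * X i j s) = (\<lambda>i j s. a * W' X i j s)"
    "\<And>X. X \<in> tensors c' \<Longrightarrow> L' X = (\<lambda>i j s. W' X i j s + B' i j s)"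
    using L' affine_mapE unfolding equivariant_layer_def by blast
  show "affine_map c c'' (L' \<circ> L)"
  proof (rule affine_mapI[where W = "W' \<circ> W" and B = "\<lambda>i j s. W' B i j s + B' i j s"])
    show "(\<lambda>i j s. W' B i j s + B' i j s) \<in> tensors c''"
      using 1(2) 2(1,2) by (simp add: mem_tensors_iff)
    fix X :: "'a tensor" assume X: "X \<in> tensors c"
    have "L X \<in> tensors c'"
      using L X by (rule equivariant_layer_in_tensors)
    then show "(L' \<circ> L) X = (\<lambda>i j s. (W' \<circ> W) X i j s + (W' B i j s + B' i j s))"
      using X 1 2 by (simp add: add.assoc)
  qed (use 1 2 in auto)
next
  fix X :: "'a tensor" and p :: "'a \<Rightarrow> 'a" assume "X \<in> tensors c" "bij p"
  then show "(L' \<circ> L) (perm_act p X) = perm_act p ((L' \<circ> L) X)"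
    using L L' equivariant_layer_in_tensors[OF L] by (simp add: equivariant_layer_def)
qed

lemma equivariant_layer_hcat:
  assumes L: "equivariant_layer c k L" and L': "equivariant_layer c k' L'"
  shows "equivariant_layer c (k + k') (\<lambda>X. hcat k (L X) (L' X))"
  unfolding equivariant_layer_def
proof (intro conjI ballI allI impI)
  obtain W B where 1: "\<And>X. X \<in> tensors c \<Longrightarrow> W X \<in> tensors k" "B \<in> tensors k"
    "\<And>X Y. X \<in> tensors c \<Longrightarrow> Y \<in> tensors c \<Longrightarrow>
       W (\<lambda>i j s. X i j s + Y i j s) = (\<lambda>i j s. W X i j s + W Y i j s)"
    "\<And>a X. X \<in> tensors c \<Longrightarrow> W (\<lambda>i j s. a * X i j s) = (\<lambda>i j s. a * W X i j s)"
    "\<And>X. X \<in> tensors c \<Longrightarrow> L X = (\<lambda>i j s. W X i j s + B i j s)"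
    using L affine_mapE unfolding equivariant_layer_def by blast
  obtain W' B' where 2: "\<And>X. X \<in> tensors c \<Longrightarrow> W' X \<in> tensors k'" "B' \<in> tensors k'"
    "\<And>X Y. X \<in> tensors c \<Longrightarrow> Y \<in> tensors c \<Longrightarrow>
       W' (\<lambda>i j s. X i j s + Y i j s) = (\<lambda>i j s. W' X i j s + W' Y i j s)"
    "\<And>a X. X \<in> tensors c \<Longrightarrow> W' (\<lambda>i j s. a * X i j s) = (\<lambda>i j s. a * W' X i j s)"
    "\<And>X. X \<in> tensors c \<Longrightarrow> L' X = (\<lambda>i j s. W' X i j s + B' i j s)"
    using L' affine_mapE unfolding equivariant_layer_def by blast
  show "affine_map c (k + k') (\<lambda>X. hcat k (L X) (L' X))"
    by (rule affine_mapI[where W = "\<lambda>X. hcat k (W X) (W' X)" and B = "hcat k B B'"])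
       (use 1 2 in \<open>auto simp: hcat_in_tensors\<close>, auto simp: hcat_def fun_eq_iff)
next
  fix X :: "'a tensor" and p :: "'a \<Rightarrow> 'a" assume "X \<in> tensors c" "bij p"
  then show "hcat k (L (perm_act p X)) (L' (perm_act p X)) = perm_act p (hcat k (L X) (L' X))"
    using L L' by (simp add: equivariant_layer_def) (simp add: hcat_def perm_act_def fun_eq_iff)
qed

lemma equivariant_layer_combination:
  assumes L: "equivariant_layer c k L" and L': "equivariant_layer c k L'"
  shows "equivariant_layer c k (\<lambda>X i j s. a * L X i j s + b * L' X i j s)"
  unfolding equivariant_layer_def
proof (intro conjI ballI allI impI)
  obtain W B where 1: "\<And>X. X \<in> tensors c \<Longrightarrow> W X \<in> tensors k" "B \<in> tensors k"
    "\<And>X Y. X \<in> tensors c \<Longrightarrow> Y \<in> tensors c \<Longrightarrow>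
       W (\<lambda>i j s. X i j s + Y i j s) = (\<lambda>i j s. W X i j s + W Y i j s)"
    "\<And>a X. X \<in> tensors c \<Longrightarrow> W (\<lambda>i j s. a * X i j s) = (\<lambda>i j s. a * W X i j s)"
    "\<And>X. X \<in> tensors c \<Longrightarrow> L X = (\<lambda>i j s. W X i j s + B i j s)"
    using L affine_mapE unfolding equivariant_layer_def by blast
  obtain W' B' where 2: "\<And>X. X \<in> tensors c \<Longrightarrow> W' X \<in> tensors k" "B' \<in> tensors k"
    "\<And>X Y. X \<in> tensors c \<Longrightarrow> Y \<in> tensors c \<Longrightarrow>
       W' (\<lambda>i j s. X i j s + Y i j s) = (\<lambda>i j s. W' X i j s + W' Y i j s)"
    "\<And>a X. X \<in> tensors c \<Longrightarrow> W' (\<lambda>i j s. a * X i j s) = (\<lambda>i j s. a * W' X i j s)"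
    "\<And>X. X \<in> tensors c \<Longrightarrow> L' X = (\<lambda>i j s. W' X i j s + B' i j s)"
    using L' affine_mapE unfolding equivariant_layer_def by blast
  show "affine_map c k (\<lambda>X i j s. a * L X i j s + b * L' X i j s)"
    by (rule affine_mapI[where W = "\<lambda>X i j s. a * W X i j s + b * W' X i j s"
          and B = "\<lambda>i j s. a * B i j s + b * B' i j s"])
       (use 1 2 in \<open>auto simp: algebra_simps mem_tensors_iff\<close>)
next
  fix X :: "'a tensor" and p :: "'a \<Rightarrow> 'a" assume "X \<in> tensors c" "bij p"
  then show "(\<lambda>i j s. a * L (perm_act p X) i j s + b * L' (perm_act p X) i j s) =
      perm_act p (\<lambda>i j s. a * L X i j s + b * L' X i j s)"
    using L L' by (simp add: equivariant_layer_def) (simp add: perm_act_def)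
qed

text \<open>The linear equivariant maps with one input and one output channel. Equivariance is
  phrased as pullback along \<open>q\<close>; \<open>q = inv p\<close> gives
  \<open>perm_act p\<close>. The constant \<open>C\<close> bounds the operator norm for the maximum
  norm, so an error \<open>e\<close> in the argument becomes at most \<open>C * e\<close>.\<close>

definition equivariant_operator :: "(('n::finite \<Rightarrow> 'n \<Rightarrow> real) \<Rightarrow> 'n \<Rightarrow> 'n \<Rightarrow> real) \<Rightarrow> bool" where
  "equivariant_operator \<Lambda> \<longleftrightarrow>
     (\<forall>Y Z. \<Lambda> (\<lambda>i j. Y i j + Z i j) = (\<lambda>i j. \<Lambda> Y i j + \<Lambda> Z i j)) \<and>
     (\<forall>a Y. \<Lambda> (\<lambda>i j. a * Y i j) = (\<lambda>i j. a * \<Lambda> Y i j)) \<and>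
     (\<forall>Y q. bij q \<longrightarrow> \<Lambda> (\<lambda>i j. Y (q i) (q j)) = (\<lambda>i j. \<Lambda> Y (q i) (q j))) \<and>
     (\<exists>C. \<forall>Y e. (\<forall>i j. \<bar>Y i j\<bar> \<le> e) \<longrightarrow> (\<forall>i j. \<bar>\<Lambda> Y i j\<bar> \<le> C * e))"

lemma equivariant_operator_id: "equivariant_operator (\<lambda>Y. Y)"
  by (auto simp: equivariant_operator_def intro: exI[of _ 1])

lemma equivariant_operator_diag_row: "equivariant_operator (\<lambda>Y i j. Y i i)"
  by (auto simp: equivariant_operator_def intro: exI[of _ 1])

lemma equivariant_operator_diag_column: "equivariant_operator (\<lambda>Y i j. Y j j)"
  by (auto simp: equivariant_operator_def intro: exI[of _ 1])

text \<open>Injectivity of \<open>q\<close> gives i = j iff q i = q j, so the diagonal is preserved.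
  Off the diagonal the bound reads 0 \<le> e, which follows from \<bar>Y i j\<bar> \<le> e.\<close>

lemma equivariant_operator_diag_part: "equivariant_operator (\<lambda>Y i j. if i = j then Y i j else 0)"
  unfolding equivariant_operator_def
  by (intro conjI exI[of _ 1]) (auto simp: fun_eq_iff bij_def inj_eq intro: order_trans[OF abs_ge_zero])

lemma equivariant_operator_row_sum: "equivariant_operator (\<lambda>Y i j. \<Sum>k\<in>UNIV. Y i k)"
  unfolding equivariant_operator_def
proof (intro conjI allI impI exI[of _ "real CARD('a)"])
  fix Y :: "'a \<Rightarrow> 'a \<Rightarrow> real" and q :: "'a \<Rightarrow> 'a" assume "bij q"
  then show "(\<lambda>i j. \<Sum>k\<in>UNIV. Y (q i) (q k)) = (\<lambda>i j. \<Sum>k\<in>UNIV. Y (q i) k)"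
    by (simp add: fun_eq_iff sum.reindex_bij_betw)
next
  fix Y :: "'a \<Rightarrow> 'a \<Rightarrow> real" and e i assume "\<forall>i j. \<bar>Y i j\<bar> \<le> e"
  then show "\<bar>\<Sum>k\<in>UNIV. Y i k\<bar> \<le> real CARD('a) * e"
    by (intro order_trans[OF sum_abs sum_bounded_above]) simp
qed (simp_all add: sum.distrib sum_distrib_left)

text \<open>Output channel \<open>s\<close> applies \<Lambda> to input channel
  \<open>\<sigma> s\<close>. This one form yields the channel projections as well as all
  single-channel operations used later; the cutoff at \<open>c'\<close> keeps the result in the
  carrier.\<close>

lemma equivariant_layer_select:
  fixes \<Lambda> :: "('n::finite \<Rightarrow> 'n \<Rightarrow> real) \<Rightarrow> 'n \<Rightarrow> 'n \<Rightarrow> real"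
  assumes "equivariant_operator \<Lambda>"
  shows "equivariant_layer c c' (\<lambda>X i j s. if s < c' then \<Lambda> (\<lambda>i j. X i j (\<sigma> s)) i j else 0)"
    (is "equivariant_layer c c' ?L")
  unfolding equivariant_layer_def
proof (intro conjI ballI allI impI)
  show "affine_map c c' ?L"
    using assms
    by (intro affine_mapI[where W = ?L and B = "\<lambda>i j s. 0"])
       (auto simp: mem_tensors_iff equivariant_operator_def fun_eq_iff)
next
  fix X :: "'n tensor" and p :: "'n \<Rightarrow> 'n" assume "bij p"
  have "\<Lambda> (\<lambda>i j. Y (inv p i) (inv p j)) i j = \<Lambda> Y (inv p i) (inv p j)" for Y i j
    using assms[unfolded equivariant_operator_def, THEN conjunct2, THEN conjunct2,
        THEN conjunct1, rule_format,
        OF bij_imp_bij_inv[OF \<open>bij p\<close>]] by metis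
  from this[of "\<lambda>i j. X i j (\<sigma> s)" for s]
  show "?L (perm_act p X) = perm_act p (?L X)"
    by (simp add: perm_act_def fun_eq_iff)
qed

lemma equivariant_layer_const:
  "equivariant_layer c c' (\<lambda>X i j s. if s < c' then b else 0)"
  unfolding equivariant_layer_def
  by (auto intro!: affine_mapI[where W = "\<lambda>X i j s. 0" and B = "\<lambda>i j s. if s < c' then b else 0"]
      simp: mem_tensors_iff perm_act_def)

lemma equivariant_layer_trunc:
  "equivariant_layer c k (trunc k :: 'n::finite tensor \<Rightarrow> 'n tensor)"
  using equivariant_layer_select[OF equivariant_operator_id, of c k "\<lambda>s. s"]
  by (simp add: trunc_def[abs_def])

text \<open>Layers are constrained only on the carrier, and \<open>perm_act p\<close> stays in it.
  This admits the identity and \<open>shift\<close>, which have the form of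
  \<open>equivariant_layer_select\<close> only there.\<close>

lemma equivariant_layer_cong:
  assumes "equivariant_layer c c' L" "\<And>X. X \<in> tensors c \<Longrightarrow> L X = L' X"
  shows "equivariant_layer c c' L'"
  using assms by (simp add: equivariant_layer_def affine_map_def perm_act_in_tensors)

lemma trunc_id: "X \<in> tensors c \<Longrightarrow> trunc c X = X"
  by (auto simp: fun_eq_iff mem_tensors_iff trunc_def)

lemma equivariant_layer_id: "equivariant_layer c c (\<lambda>X :: 'n::finite tensor. X)"
  using equivariant_layer_trunc trunc_id by (rule equivariant_layer_cong)

lemma equivariant_layer_shift:
  "equivariant_layer (c + k) k (shift c :: 'n::finite tensor \<Rightarrow> 'n tensor)"
proof (rule equivariant_layer_cong)
  show "equivariant_layer (c + k) k (\<lambda>(X :: 'n tensor) i j s. if s < k then X i j (c + s) else 0)"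
    using equivariant_layer_select[OF equivariant_operator_id, of "c + k" k "\<lambda>s. c + s"] .
qed (auto simp: shift_def mem_tensors_iff fun_eq_iff)

section \<open>Serial and parallel composition of networks\<close>

lemma equivariant_network_in_tensors:
  "equivariant_network c c' F \<Longrightarrow> X \<in> tensors c \<Longrightarrow> F X \<in> tensors c'"
  by (induction rule: equivariant_network.induct)
     (simp_all add: equivariant_layer_in_tensors relu_in_tensors)

text \<open>The new layer is absorbed into the last layer of the network, so no ReLU comes
  between.\<close>

lemma equivariant_network_layer:
  assumes "equivariant_network c c' F" "equivariant_layer c' c'' L"
  shows "equivariant_network c c'' (L \<circ> F)"
  using assms
proof (cases rule: equivariant_network.cases)
  case layer
  then show ?thesis
    using assms(2) by (intro equivariant_network.layer equivariant_layer_comp)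
next
  case (comp k G L1)
  have "equivariant_network c c'' ((L \<circ> L1) \<circ> relu \<circ> G)"
    using comp assms(2) by (intro equivariant_network.comp equivariant_layer_comp)
  then show ?thesis
    using comp by (simp add: o_assoc)
qed

text \<open>Induction on the outer network: its innermost layer merges with the last layer of
  \<open>F\<close>, and the remaining layers are stacked on top.\<close>

lemma equivariant_network_comp:
  assumes "equivariant_network c' c'' G" "equivariant_network c c' F"
  shows "equivariant_network c c'' (G \<circ> F)"
  using assms
proof (induction rule: equivariant_network.induct)
  case (layer c' c'' L)
  then show ?case by (blast intro: equivariant_network_layer)
next
  case (comp c1 c2 G c3 L)
  have "equivariant_network c c3 (L \<circ> relu \<circ> (G \<circ> F))"
    by (intro equivariant_network.comp[OF comp.IH[OF comp.prems] comp.hyps(2,3)])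
  then show ?case
    by (simp only: o_assoc)
qed

text \<open>
  Further channels are carried past a network unchanged, since
  \<open>y = max y 0 - max (- y) 0\<close>. This replaces equalizing the depths of two networks.
\<close>

lemma equivariant_network_carry:
  fixes F :: "'n::finite tensor \<Rightarrow> 'n tensor"
  assumes "equivariant_network c c' F"
  shows "\<exists>G. equivariant_network (c + k) (c' + k) G \<and>
    (\<forall>X\<in>tensors (c + k). G X = hcat c' (F (trunc c X)) (shift c X))"
  using assms
proof (induction rule: equivariant_network.induct)
  case (layer c c' L)
  have "equivariant_layer (c + k) (c' + k) (\<lambda>X. hcat c' ((L \<circ> trunc c) X) (shift c X))"
    by (intro equivariant_layer_hcat equivariant_layer_comp[OF equivariant_layer_trunc]
        equivariant_layer_shift layer)
  then show ?case
    by (intro exI conjI equivariant_network.layer) auto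
next
  case (comp c c' F c'' L)
  then obtain G where G: "equivariant_network (c + k) (c' + k) G"
    and GX: "\<And>X. X \<in> tensors (c + k) \<Longrightarrow> G X = hcat c' (F (trunc c X)) (shift c X)"
    by blast
  \<comment> \<open>With y the carried channels, \<open>P\<close> turns [F, y] into [F, y, -y].
    After ReLU, \<open>Q\<close> applies \<open>L\<close> to the first block and subtracts the third
    from the second, restoring y. The negation has a summand with factor 0 to match the shape in
    \<open>equivariant_layer_combination\<close>.\<close>
  define P :: "'n tensor \<Rightarrow> 'n tensor" where
    "P = (\<lambda>X. hcat (c' + k) X (\<lambda>i j s. (-1) * shift c' X i j s + 0 * shift c' X i j s))"
  define Q :: "'n tensor \<Rightarrow> 'n tensor" where
    "Q = (\<lambda>X. hcat c'' ((L \<circ> trunc c') X)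
       (\<lambda>i j s. 1 * (shift c' \<circ> trunc (c' + k)) X i j s + (-1) * shift (c' + k) X i j s))"
  have P: "equivariant_layer (c' + k) (c' + k + k) P"
    unfolding P_def by (intro equivariant_layer_hcat equivariant_layer_id
        equivariant_layer_combination equivariant_layer_shift)
  have Q: "equivariant_layer (c' + k + k) (c'' + k) Q"
    unfolding Q_def by (intro equivariant_layer_hcat equivariant_layer_combination
        equivariant_layer_shift equivariant_layer_comp[OF equivariant_layer_trunc] comp.hyps)
  have "equivariant_network (c + k) (c'' + k) (Q \<circ> relu \<circ> (P \<circ> G))"
    using comp.hyps by (intro equivariant_network.comp[OF _ _ Q] equivariant_network_layer[OF G P]) auto
  moreover have "(Q \<circ> relu \<circ> (P \<circ> G)) X = hcat c'' ((L \<circ> relu \<circ> F) (trunc c X)) (shift c X)"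
    if X: "X \<in> tensors (c + k)" for X
  proof -
    have F: "F (trunc c X) \<in> tensors c'"
      using comp.hyps(1) trunc_in_tensors by (rule equivariant_network_in_tensors)
    let ?Y = "relu (P (G X))"
    have "trunc c' ?Y = relu (F (trunc c X))"
      using F by (auto simp: GX[OF X] fun_eq_iff trunc_def relu_def P_def hcat_def mem_tensors_iff)
    moreover have "shift c' (trunc (c' + k) ?Y) i j s - shift (c' + k) ?Y i j s = shift c X i j s" for i j s
      using shift_in_tensors[OF X]
      by (auto simp: GX[OF X] fun_eq_iff trunc_def relu_def P_def hcat_def shift_def mem_tensors_iff)
    ultimately show ?thesis
      by (simp add: Q_def)
  qed
  ultimately show ?case by blast
qed

text \<open>The two networks run one after the other, each carrying what the other needs: X, [X, X],
  [F' X, X], [X, F' X], [F X, F' X]. Their depths need not agree.\<close>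

lemma equivariant_network_hcat:
  fixes F :: "'n::finite tensor \<Rightarrow> 'n tensor"
  assumes F: "equivariant_network c k F" and F': "equivariant_network c k' F'"
  shows "\<exists>G. equivariant_network c (k + k') G \<and> (\<forall>X\<in>tensors c. G X = hcat k (F X) (F' X))"
proof -
  obtain G' where G': "equivariant_network (c + c) (k' + c) G'"
    "\<And>X. X \<in> tensors (c + c) \<Longrightarrow> G' X = hcat k' (F' (trunc c X)) (shift c X)"
    using equivariant_network_carry[OF F'] by blast
  obtain G where G: "equivariant_network (c + k') (k + k') G"
    "\<And>X. X \<in> tensors (c + k') \<Longrightarrow> G X = hcat k (F (trunc c X)) (shift c X)"
    using equivariant_network_carry[OF F] by blast
  define P :: "'n tensor \<Rightarrow> 'n tensor" where "P = (\<lambda>X. hcat c X X)"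
  define Q :: "'n tensor \<Rightarrow> 'n tensor" where "Q = (\<lambda>X. hcat c (shift k' X) (trunc k' X))"
  have P: "equivariant_layer c (c + c) P" and Q: "equivariant_layer (k' + c) (c + k') Q"
    unfolding P_def Q_def by (intro equivariant_layer_hcat equivariant_layer_id
        equivariant_layer_shift equivariant_layer_trunc)+
  have "equivariant_network c (k + k') (G \<circ> (Q \<circ> (G' \<circ> P)))"
    by (intro equivariant_network_comp[OF G(1)] equivariant_network_layer[OF _ Q]
        equivariant_network_comp[OF G'(1)] equivariant_network.layer[OF P])
  moreover have "(G \<circ> (Q \<circ> (G' \<circ> P))) X = hcat k (F X) (F' X)" if X: "X \<in> tensors c" for X
  proof -
    have 1: "G' (P X) = hcat k' (F' X) X"
      using X G'(2)[of "P X"] by (simp add: P_def hcat_in_tensors trunc_hcat shift_hcat)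
    have 2: "F' X \<in> tensors k'"
      using F' X by (rule equivariant_network_in_tensors)
    have 3: "Q (G' (P X)) = hcat c X (F' X)"
      by (simp add: Q_def 1 shift_hcat trunc_hcat[OF 2])
    show ?thesis
      using G(2)[of "hcat c X (F' X)"] X 2
      by (simp add: 3 hcat_in_tensors trunc_hcat shift_hcat)
  qed
  ultimately show ?thesis by blast
qed

subsection \<open>Uniformly approximable functions\<close>

text \<open>Turns the accuracy wanted for a composite into one for its parts. Dividing by
  \<bar>C\<bar> + 1 covers every real \<open>C\<close>, including 0.\<close>

lemma obtain_small_multiple:
  fixes \<epsilon> C :: real
  assumes "\<epsilon> > 0"
  obtains e where "e > 0" "C * e \<le> \<epsilon>"
proof
  show "\<epsilon> / (\<bar>C\<bar> + 1) > 0"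
    using assms by (simp add: add_nonneg_pos)
  have "C * \<epsilon> \<le> (\<bar>C\<bar> + 1) * \<epsilon>"
    using assms by (intro mult_right_mono) auto
  then show "C * (\<epsilon> / (\<bar>C\<bar> + 1)) \<le> \<epsilon>"
    by (simp add: pos_divide_le_eq add_nonneg_pos mult.commute)
qed

text \<open>\<omega> will be a triple of adjacency matrix, node features and edge features.
  \<open>D\<close> carries no topology; compact sets are recovered from bounds on the values of
  approximable functions.\<close>

locale approximation =
  fixes c :: nat and D :: "'w set" and enc :: "'w \<Rightarrow> 'n::finite tensor"
  assumes enc_in_tensors: "\<omega> \<in> D \<Longrightarrow> enc \<omega> \<in> tensors c"
begin

text \<open>Boundedness is recorded separately because \<open>D\<close> is arbitrary: it allows
  rescaling into the unit interval for squares and puts values into compact boxes for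
  Stone-Weierstrass.\<close>

definition approximable :: "('w \<Rightarrow> 'n \<Rightarrow> 'n \<Rightarrow> real) \<Rightarrow> bool" where
  "approximable g \<longleftrightarrow>
     (\<exists>B. \<forall>\<omega>\<in>D. \<forall>i j. \<bar>g \<omega> i j\<bar> \<le> B) \<and>
     (\<forall>\<epsilon>>0. \<exists>F. equivariant_network c 1 F \<and> (\<forall>\<omega>\<in>D. \<forall>i j. \<bar>F (enc \<omega>) i j 0 - g \<omega> i j\<bar> \<le> \<epsilon>))"

lemma approximableI:
  assumes "\<And>\<omega> i j. \<omega> \<in> D \<Longrightarrow> \<bar>g \<omega> i j\<bar> \<le> B"
    and "\<And>\<epsilon>. \<epsilon> > 0 \<Longrightarrow> \<exists>F. equivariant_network c 1 F \<and> (\<forall>\<omega>\<in>D. \<forall>i j. \<bar>F (enc \<omega>) i j 0 - g \<omega> i j\<bar> \<le> \<epsilon>)"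
  shows "approximable g"
  using assms unfolding approximable_def by blast

lemma approximable_bounded:
  "approximable g \<Longrightarrow> \<exists>B. \<forall>\<omega>\<in>D. \<forall>i j. \<bar>g \<omega> i j\<bar> \<le> B"
  by (simp add: approximable_def)

lemma approximable_network:
  "approximable g \<Longrightarrow> \<epsilon> > 0 \<Longrightarrow>
    \<exists>F. equivariant_network c 1 F \<and> (\<forall>\<omega>\<in>D. \<forall>i j. \<bar>F (enc \<omega>) i j 0 - g \<omega> i j\<bar> \<le> \<epsilon>)"
  by (simp add: approximable_def)

lemma approximable_cong:
  assumes "approximable g" "\<And>\<omega> i j. \<omega> \<in> D \<Longrightarrow> g \<omega> i j = h \<omega> i j"
  shows "approximable h"
  using assms by (simp add: approximable_def)

lemma approximable_limit:
  assumes "\<And>\<epsilon>. \<epsilon> > 0 \<Longrightarrow> \<exists>h. approximable h \<and> (\<forall>\<omega>\<in>D. \<forall>i j. \<bar>h \<omega> i j - g \<omega> i j\<bar> \<le> \<epsilon>)"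
  shows "approximable g"
proof -
  \<comment> \<open>Tolerance 1 is an arbitrary choice; this \<open>h\<close> serves only to bound
    \<open>g\<close>.\<close>
  obtain h where h: "approximable h" "\<And>\<omega> i j. \<omega> \<in> D \<Longrightarrow> \<bar>h \<omega> i j - g \<omega> i j\<bar> \<le> 1"
    using assms[OF zero_less_one] by blast
  obtain B where B: "\<And>\<omega> i j. \<omega> \<in> D \<Longrightarrow> \<bar>h \<omega> i j\<bar> \<le> B"
    using approximable_bounded[OF h(1)] by blast
  show ?thesis
  proof (rule approximableI)
    show "\<bar>g \<omega> i j\<bar> \<le> B + 1" if "\<omega> \<in> D" for \<omega> i j
      using h(2)[OF that, of i j] B[OF that, of i j] by linarith
    fix \<epsilon> :: real assume \<epsilon>: "\<epsilon> > 0"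
    obtain h where h: "approximable h" "\<And>\<omega> i j. \<omega> \<in> D \<Longrightarrow> \<bar>h \<omega> i j - g \<omega> i j\<bar> \<le> \<epsilon> / 2"
      using assms[OF half_gt_zero[OF \<epsilon>]] by blast
    obtain F where F: "equivariant_network c 1 F"
      "\<And>\<omega> i j. \<omega> \<in> D \<Longrightarrow> \<bar>F (enc \<omega>) i j 0 - h \<omega> i j\<bar> \<le> \<epsilon> / 2"
      using approximable_network[OF h(1) half_gt_zero[OF \<epsilon>]] by blast
    have "\<bar>F (enc \<omega>) i j 0 - g \<omega> i j\<bar> \<le> \<epsilon>" if "\<omega> \<in> D" for \<omega> i j
      using h(2)[OF that, of i j] F(2)[OF that, of i j] by linarith
    then show "\<exists>F. equivariant_network c 1 F \<and> (\<forall>\<omega>\<in>D. \<forall>i j. \<bar>F (enc \<omega>) i j 0 - g \<omega> i j\<bar> \<le> \<epsilon>)"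
      using F(1) by blast
  qed
qed

section \<open>Closure under linear operations and ReLU\<close>

lemma approximable_channel:
  assumes "\<And>\<omega> i j. \<omega> \<in> D \<Longrightarrow> \<bar>enc \<omega> i j k\<bar> \<le> B"
  shows "approximable (\<lambda>\<omega> i j. enc \<omega> i j k)"
proof (rule approximableI)
  fix \<epsilon> :: real assume \<epsilon>: "\<epsilon> > 0"
  let ?L = "\<lambda>(X :: 'n tensor) i j (s :: nat). if s < 1 then X i j k else 0"
  have "equivariant_network c 1 ?L"
    using equivariant_layer_select[OF equivariant_operator_id] by (rule equivariant_network.layer)
  moreover have "\<bar>?L (enc \<omega>) i j 0 - enc \<omega> i j k\<bar> \<le> \<epsilon>" for \<omega> i j
    using \<epsilon> by simp
  ultimately show "\<exists>F. equivariant_network c 1 F \<and> (\<forall>\<omega>\<in>D. \<forall>i j. \<bar>F (enc \<omega>) i j 0 - enc \<omega> i j k\<bar> \<le> \<epsilon>)"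
    by blast
qed (rule assms)

lemma approximable_const: "approximable (\<lambda>\<omega> i j. b)"
proof (rule approximableI)
  fix \<epsilon> :: real assume \<epsilon>: "\<epsilon> > 0"
  let ?L = "\<lambda>(X :: 'n tensor) (i :: 'n) (j :: 'n) s. if s < (1 :: nat) then b else 0"
  have "equivariant_network c 1 ?L"
    using equivariant_layer_const by (rule equivariant_network.layer)
  moreover have "\<bar>?L (enc \<omega>) i j 0 - b\<bar> \<le> \<epsilon>" for \<omega> i j
    using \<epsilon> by simp
  ultimately show "\<exists>F. equivariant_network c 1 F \<and> (\<forall>\<omega>\<in>D. \<forall>i j. \<bar>F (enc \<omega>) i j 0 - b\<bar> \<le> \<epsilon>)"
    by blast
qed (rule order_refl)

text \<open>Both approximating networks are put into one with two output channels, and a final layer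
  combines these. Errors are scaled by at most \<bar>a\<bar> + \<bar>b\<bar>.\<close>

lemma approximable_combination:
  assumes g: "approximable g" and h: "approximable h"
  shows "approximable (\<lambda>\<omega> i j. a * g \<omega> i j + b * h \<omega> i j)"
proof -
  have *: "\<bar>a * x + b * y\<bar> \<le> (\<bar>a\<bar> + \<bar>b\<bar>) * e" if "\<bar>x\<bar> \<le> e" "\<bar>y\<bar> \<le> e" for x y e :: real
  proof -
    have "\<bar>a * x + b * y\<bar> \<le> \<bar>a\<bar> * \<bar>x\<bar> + \<bar>b\<bar> * \<bar>y\<bar>"
      by (metis abs_mult abs_triangle_ineq)
    also have "\<dots> \<le> \<bar>a\<bar> * e + \<bar>b\<bar> * e"
      using that by (intro add_mono mult_left_mono) auto
    finally show ?thesis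
      by (simp add: algebra_simps)
  qed
  obtain B where B: "\<And>\<omega> i j. \<omega> \<in> D \<Longrightarrow> \<bar>g \<omega> i j\<bar> \<le> B"
    using approximable_bounded[OF g] by blast
  obtain B' where B': "\<And>\<omega> i j. \<omega> \<in> D \<Longrightarrow> \<bar>h \<omega> i j\<bar> \<le> B'"
    using approximable_bounded[OF h] by blast
  show ?thesis
  proof (rule approximableI)
    show "\<bar>a * g \<omega> i j + b * h \<omega> i j\<bar> \<le> (\<bar>a\<bar> + \<bar>b\<bar>) * max B B'" if "\<omega> \<in> D" for \<omega> i j
      using B[OF that, of i j] B'[OF that, of i j] by (intro *) auto
    fix \<epsilon> :: real assume \<epsilon>: "\<epsilon> > 0"
    obtain e where e: "e > 0" "(\<bar>a\<bar> + \<bar>b\<bar>) * e \<le> \<epsilon>"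
      by (rule obtain_small_multiple[OF \<epsilon>])
    obtain F where F: "equivariant_network c 1 F"
      "\<And>\<omega> i j. \<omega> \<in> D \<Longrightarrow> \<bar>F (enc \<omega>) i j 0 - g \<omega> i j\<bar> \<le> e"
      using approximable_network[OF g e(1)] by blast
    obtain F' where F': "equivariant_network c 1 F'"
      "\<And>\<omega> i j. \<omega> \<in> D \<Longrightarrow> \<bar>F' (enc \<omega>) i j 0 - h \<omega> i j\<bar> \<le> e"
      using approximable_network[OF h e(1)] by blast
    obtain G where G: "equivariant_network c (1 + 1) G"
      "\<And>X. X \<in> tensors c \<Longrightarrow> G X = hcat 1 (F X) (F' X)"
      using equivariant_network_hcat[OF F(1) F'(1)] by blast
    let ?L = "\<lambda>(X :: 'n tensor) i j s. a * trunc 1 X i j s + b * shift 1 X i j s"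
    have "equivariant_network c 1 (?L \<circ> G)"
      by (intro equivariant_network_layer[OF G(1)] equivariant_layer_combination
          equivariant_layer_trunc equivariant_layer_shift)
    moreover have "\<bar>(?L \<circ> G) (enc \<omega>) i j 0 - (a * g \<omega> i j + b * h \<omega> i j)\<bar> \<le> \<epsilon>"
      if \<omega>: "\<omega> \<in> D" for \<omega> i j
    proof -
      have "(?L \<circ> G) (enc \<omega>) i j 0 - (a * g \<omega> i j + b * h \<omega> i j) =
          a * (F (enc \<omega>) i j 0 - g \<omega> i j) + b * (F' (enc \<omega>) i j 0 - h \<omega> i j)"
        using G(2)[OF enc_in_tensors[OF \<omega>]]
        by (simp add: trunc_def shift_def hcat_def algebra_simps)
      also have "\<bar>\<dots>\<bar> \<le> (\<bar>a\<bar> + \<bar>b\<bar>) * e"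
        using F(2)[OF \<omega>] F'(2)[OF \<omega>] by (intro *) auto
      finally show ?thesis
        using e(2) by linarith
    qed
    ultimately show "\<exists>F. equivariant_network c 1 F \<and>
        (\<forall>\<omega>\<in>D. \<forall>i j. \<bar>F (enc \<omega>) i j 0 - (a * g \<omega> i j + b * h \<omega> i j)\<bar> \<le> \<epsilon>)"
      by blast
  qed
qed

lemma approximable_add:
  "approximable g \<Longrightarrow> approximable h \<Longrightarrow> approximable (\<lambda>\<omega> i j. g \<omega> i j + h \<omega> i j)"
  using approximable_combination[of g h 1 1] by simp

lemma approximable_affine:
  "approximable g \<Longrightarrow> approximable (\<lambda>\<omega> i j. a * g \<omega> i j + b)"
  using approximable_combination[OF _ approximable_const[of 1], of g a b] by simp

lemma approximable_operator:
  assumes \<Lambda>: "equivariant_operator \<Lambda>" and g: "approximable g"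
  shows "approximable (\<lambda>\<omega>. \<Lambda> (g \<omega>))"
proof -
  obtain C where C: "\<And>Y e i j. (\<And>i j. \<bar>Y i j\<bar> \<le> e) \<Longrightarrow> \<bar>\<Lambda> Y i j\<bar> \<le> C * e"
    using \<Lambda> unfolding equivariant_operator_def by metis
  have diff: "\<Lambda> (\<lambda>i j. Y i j - Z i j) i j = \<Lambda> Y i j - \<Lambda> Z i j" for Y Z i j
  proof -
    have "\<Lambda> (\<lambda>i j. Y i j + (-1) * Z i j) i j = \<Lambda> Y i j + (-1) * \<Lambda> Z i j"
      using \<Lambda> unfolding equivariant_operator_def by metis
    then show ?thesis by simp
  qed
  obtain B where B: "\<And>\<omega> i j. \<omega> \<in> D \<Longrightarrow> \<bar>g \<omega> i j\<bar> \<le> B"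
    using approximable_bounded[OF g] by blast
  show ?thesis
  proof (rule approximableI)
    show "\<bar>\<Lambda> (g \<omega>) i j\<bar> \<le> C * B" if "\<omega> \<in> D" for \<omega> i j
      using B[OF that] by (rule C)
    fix \<epsilon> :: real assume \<epsilon>: "\<epsilon> > 0"
    obtain e where e: "e > 0" "C * e \<le> \<epsilon>"
      by (rule obtain_small_multiple[OF \<epsilon>])
    obtain F where F: "equivariant_network c 1 F"
      "\<And>\<omega> i j. \<omega> \<in> D \<Longrightarrow> \<bar>F (enc \<omega>) i j 0 - g \<omega> i j\<bar> \<le> e"
      using approximable_network[OF g e(1)] by blast
    let ?L = "\<lambda>(X :: 'n tensor) i j (s :: nat). if s < 1 then \<Lambda> (\<lambda>i j. X i j 0) i j else 0"
    have "equivariant_network c 1 (?L \<circ> F)"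
      using equivariant_layer_select[OF \<Lambda>] by (rule equivariant_network_layer[OF F(1)])
    moreover have "\<bar>(?L \<circ> F) (enc \<omega>) i j 0 - \<Lambda> (g \<omega>) i j\<bar> \<le> \<epsilon>" if \<omega>: "\<omega> \<in> D" for \<omega> i j
    proof -
      have "\<bar>(?L \<circ> F) (enc \<omega>) i j 0 - \<Lambda> (g \<omega>) i j\<bar> \<le> C * e"
        using C[of "\<lambda>i j. F (enc \<omega>) i j 0 - g \<omega> i j" e i j] F(2)[OF \<omega>] by (simp add: diff)
      then show ?thesis
        using e(2) by linarith
    qed
    ultimately show "\<exists>F. equivariant_network c 1 F \<and> (\<forall>\<omega>\<in>D. \<forall>i j. \<bar>F (enc \<omega>) i j 0 - \<Lambda> (g \<omega>) i j\<bar> \<le> \<epsilon>)"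
      by blast
  qed
qed

text \<open>ReLU is 1-Lipschitz, so the accuracy carries over unchanged. An identity layer follows
  it because networks end with an affine layer.\<close>

lemma approximable_relu:
  assumes g: "approximable g"
  shows "approximable (\<lambda>\<omega> i j. max (g \<omega> i j) 0)"
proof -
  obtain B where B: "\<And>\<omega> i j. \<omega> \<in> D \<Longrightarrow> \<bar>g \<omega> i j\<bar> \<le> B"
    using approximable_bounded[OF g] by blast
  show ?thesis
  proof (rule approximableI)
    show "\<bar>max (g \<omega> i j) 0\<bar> \<le> B" if "\<omega> \<in> D" for \<omega> i j
      using B[OF that, of i j] by linarith
    fix \<epsilon> :: real assume \<epsilon>: "\<epsilon> > 0"
    obtain F where F: "equivariant_network c 1 F"
      "\<And>\<omega> i j. \<omega> \<in> D \<Longrightarrow> \<bar>F (enc \<omega>) i j 0 - g \<omega> i j\<bar> \<le> \<epsilon>"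
      using approximable_network[OF g \<epsilon>] by blast
    have "\<bar>((\<lambda>X. X) \<circ> relu \<circ> F) (enc \<omega>) i j 0 - max (g \<omega> i j) 0\<bar> \<le> \<epsilon>" if "\<omega> \<in> D" for \<omega> i j
      using F(2)[OF that, of i j] by (auto simp: relu_def)
    then show "\<exists>F. equivariant_network c 1 F \<and> (\<forall>\<omega>\<in>D. \<forall>i j. \<bar>F (enc \<omega>) i j 0 - max (g \<omega> i j) 0\<bar> \<le> \<epsilon>)"
      using equivariant_network.comp[OF F(1) _ equivariant_layer_id] by blast
  qed
qed

section \<open>Squares and products obtained from ReLU\<close>

lemma approximable_abs:
  assumes g: "approximable g"
  shows "approximable (\<lambda>\<omega> i j. \<bar>g \<omega> i j\<bar>)"
proof (rule approximable_cong)
  show "approximable (\<lambda>\<omega> i j. max (g \<omega> i j) 0 + max ((-1) * g \<omega> i j + 0) 0)"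
    by (intro approximable_add approximable_relu approximable_affine g)
qed auto

text \<open>
  The parabola \<open>f x = x (1 - x)\<close> satisfies \<open>f x = \<tau> x / 4 + f (\<tau> x) / 4\<close> for the
  tent map \<open>\<tau> x = 1 - \<bar>2 x - 1\<bar>\<close>, so iterating \<open>\<tau>\<close> approximates it with geometric speed.
\<close>

lemma parabola_approximation:
  assumes "approximable g" "\<And>\<omega> i j. \<omega> \<in> D \<Longrightarrow> g \<omega> i j \<in> {0..1}"
  shows "\<exists>h. approximable h \<and> (\<forall>\<omega>\<in>D. \<forall>i j. \<bar>h \<omega> i j - g \<omega> i j * (1 - g \<omega> i j)\<bar> \<le> (1/4) ^ k)"
  using assms
proof (induction k arbitrary: g)
  case 0
  \<comment> \<open>The iteration starts from the zero function, whose error on the unit interval is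
    at most 1 = (1/4)^0.\<close>
  have "\<bar>x * (1 - x)\<bar> \<le> 1" if "x \<in> {0..1}" for x :: real
    using that mult_mono[of x 1 "1 - x" 1] by (auto simp: abs_mult)
  then show ?case
    using 0 by (intro exI[of _ "\<lambda>\<omega> i j. 0"]) (auto simp: approximable_const)
next
  case (Suc k)
  \<comment> \<open>The tent map applied to \<open>g\<close>. It stays in the unit interval, so the
    induction hypothesis applies to \<open>t\<close> in place of \<open>g\<close>, and its error
    enters with factor 1/4.\<close>
  define t where "t = (\<lambda>\<omega> i j. (-1) * \<bar>2 * g \<omega> i j + (-1)\<bar> + 1)"
  have t: "approximable t"
    unfolding t_def by (intro approximable_affine approximable_abs Suc.prems)
  moreover have "t \<omega> i j \<in> {0..1}" if "\<omega> \<in> D" for \<omega> i j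
    using Suc.prems(2)[OF that, of i j] by (auto simp: t_def)
  ultimately obtain h where h: "approximable h"
    "\<And>\<omega> i j. \<omega> \<in> D \<Longrightarrow> \<bar>h \<omega> i j - t \<omega> i j * (1 - t \<omega> i j)\<bar> \<le> (1/4) ^ k"
    using Suc.IH by blast
  have "\<bar>(1/4) * t \<omega> i j + (1/4) * h \<omega> i j - g \<omega> i j * (1 - g \<omega> i j)\<bar> \<le> (1/4) ^ Suc k"
    if \<omega>: "\<omega> \<in> D" for \<omega> i j
  proof -
    have "t \<omega> i j / 4 + t \<omega> i j * (1 - t \<omega> i j) / 4 = g \<omega> i j * (1 - g \<omega> i j)"
      by (auto simp: t_def abs_if field_simps)
    then have eq: "(1/4) * t \<omega> i j + (1/4) * h \<omega> i j - g \<omega> i j * (1 - g \<omega> i j) =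
        (h \<omega> i j - t \<omega> i j * (1 - t \<omega> i j)) / 4"
      by (simp add: field_simps)
    show ?thesis
      unfolding eq using h(2)[OF \<omega>, of i j] by simp
  qed
  then show ?case
    using approximable_combination[OF t h(1), of "1/4" "1/4"] by blast
qed

lemma approximable_parabola:
  assumes "approximable g" "\<And>\<omega> i j. \<omega> \<in> D \<Longrightarrow> g \<omega> i j \<in> {0..1}"
  shows "approximable (\<lambda>\<omega> i j. g \<omega> i j * (1 - g \<omega> i j))"
proof (rule approximable_limit)
  fix \<epsilon> :: real assume "\<epsilon> > 0"
  then obtain k where "(1/4) ^ k < \<epsilon>"
    using real_arch_pow_inv[of \<epsilon> "1/4"] by auto
  then show "\<exists>h. approximable h \<and> (\<forall>\<omega>\<in>D. \<forall>i j. \<bar>h \<omega> i j - g \<omega> i j * (1 - g \<omega> i j)\<bar> \<le> \<epsilon>)"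
    using parabola_approximation[OF assms, of k] by (meson less_imp_le order_trans)
qed

lemma approximable_square:
  assumes g: "approximable g"
  shows "approximable (\<lambda>\<omega> i j. g \<omega> i j * g \<omega> i j)"
proof -
  obtain B0 where B0: "\<And>\<omega> i j. \<omega> \<in> D \<Longrightarrow> \<bar>g \<omega> i j\<bar> \<le> B0"
    using approximable_bounded[OF g] by blast
  \<comment> \<open>The maximum with 1 makes the divisor below positive even if \<open>g\<close>
    vanishes or \<open>D\<close> is empty.\<close>
  define B where "B = max B0 1"
  have B: "B > 0" "\<And>\<omega> i j. \<omega> \<in> D \<Longrightarrow> \<bar>g \<omega> i j\<bar> \<le> B"
    using B0 by (auto simp: B_def le_max_iff_disj)
  \<comment> \<open>Rescaling [-B, B] to [0, 1] gives y (1 - y) = 1/4 - g^2 / (4 B^2), which is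
    affine in the square and can be solved for it.\<close>
  define y where "y = (\<lambda>\<omega> i j. 1 / (2 * B) * g \<omega> i j + 1 / 2)"
  have "y \<omega> i j \<in> {0..1}" if "\<omega> \<in> D" for \<omega> i j
    using B(1) B(2)[OF that, of i j] by (auto simp: y_def field_simps)
  then have y: "approximable (\<lambda>\<omega> i j. y \<omega> i j * (1 - y \<omega> i j))"
    unfolding y_def by (intro approximable_parabola approximable_affine g)
  show ?thesis
  proof (rule approximable_cong)
    show "approximable (\<lambda>\<omega> i j. (-4 * B\<^sup>2) * (y \<omega> i j * (1 - y \<omega> i j)) + B\<^sup>2)"
      using y by (rule approximable_affine)
    show "(-4 * B\<^sup>2) * (y \<omega> i j * (1 - y \<omega> i j)) + B\<^sup>2 = g \<omega> i j * g \<omega> i j" for \<omega> i j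
      using B(1) by (simp add: y_def field_simps power2_eq_square)
  qed
qed

text \<open>Polarization: g h = ((g + h)^2 - (g^2 + h^2)) / 2.\<close>

lemma approximable_mult:
  assumes g: "approximable g" and h: "approximable h"
  shows "approximable (\<lambda>\<omega> i j. g \<omega> i j * h \<omega> i j)"
proof (rule approximable_cong)
  let ?s = "\<lambda>\<omega> i j. (g \<omega> i j + h \<omega> i j) * (g \<omega> i j + h \<omega> i j)"
  let ?q = "\<lambda>\<omega> i j. g \<omega> i j * g \<omega> i j + h \<omega> i j * h \<omega> i j"
  show "approximable (\<lambda>\<omega> i j. 1/2 * ?s \<omega> i j + (-1/2) * ?q \<omega> i j)"
    by (intro approximable_combination approximable_square approximable_add g h)
qed (simp add: algebra_simps)

text \<open>The continuous f on \<open>S\<close> for which f composed with \<open>P\<close> is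
  approximable form an algebra containing the constants. If it separates points, Stone-Weierstrass
  makes it uniformly dense on \<open>S\<close>; composing with \<open>P\<close> turns this into
  uniform density over \<open>D\<close>.\<close>

lemma approximable_continuous:
  fixes P :: "'w \<Rightarrow> 'n \<Rightarrow> 'n \<Rightarrow> 'a::t2_space"
  assumes "compact S" and P: "\<And>\<omega> i j. \<omega> \<in> D \<Longrightarrow> P \<omega> i j \<in> S"
    and sep: "\<And>x y. x \<in> S \<Longrightarrow> y \<in> S \<Longrightarrow> x \<noteq> y \<Longrightarrow>
      \<exists>f. continuous_on S f \<and> approximable (\<lambda>\<omega> i j. f (P \<omega> i j)) \<and> f x \<noteq> f y"
    and "continuous_on S \<phi>"
  shows "approximable (\<lambda>\<omega> i j. \<phi> (P \<omega> i j))"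
proof (rule approximable_limit)
  let ?R = "\<lambda>f. continuous_on S f \<and> approximable (\<lambda>\<omega> i j. f (P \<omega> i j))"
  fix \<epsilon> :: real assume "\<epsilon> > 0"
  have "\<exists>f. ?R f \<and> (\<forall>x\<in>S. \<bar>\<phi> x - f x\<bar> < \<epsilon>)"
    by (rule Stone_Weierstrass_HOL[of S ?R])
       (use assms \<open>\<epsilon> > 0\<close> in \<open>auto intro!: continuous_intros approximable_const approximable_add approximable_mult\<close>)
  then obtain f where "?R f" "\<And>x. x \<in> S \<Longrightarrow> \<bar>\<phi> x - f x\<bar> < \<epsilon>"
    by blast
  then show "\<exists>h. approximable h \<and> (\<forall>\<omega>\<in>D. \<forall>i j. \<bar>h \<omega> i j - \<phi> (P \<omega> i j)\<bar> \<le> \<epsilon>)"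
    using P by (intro exI[of _ "\<lambda>\<omega> i j. f (P \<omega> i j)"]) (auto simp: abs_minus_commute intro: less_imp_le)
qed

text \<open>By Tychonoff a product of intervals is compact, and each coordinate has its own bound.
  The factors {0} from coordinate \<open>k\<close> on keep the box inside
  \<open>vecs k\<close>.\<close>

lemma approximable_compact_range:
  fixes x :: "'w \<Rightarrow> 'n \<Rightarrow> 'n \<Rightarrow> vec"
  assumes "\<And>s. approximable (\<lambda>\<omega> i j. x \<omega> i j s)" "\<And>\<omega> i j. \<omega> \<in> D \<Longrightarrow> x \<omega> i j \<in> vecs k"
  shows "\<exists>S. compact S \<and> S \<subseteq> vecs k \<and> (\<forall>\<omega>\<in>D. \<forall>i j. x \<omega> i j \<in> S)"
proof -
  have "\<exists>B. \<forall>\<omega>\<in>D. \<forall>i j. \<bar>x \<omega> i j s\<bar> \<le> B" for s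
    using assms(1) by (rule approximable_bounded)
  then obtain B where B: "\<And>s \<omega> i j. \<omega> \<in> D \<Longrightarrow> \<bar>x \<omega> i j s\<bar> \<le> B s"
    by metis
  define I where "I = (\<lambda>s. if s < k then {- B s..B s} else {0})"
  have "compactin (product_topology (\<lambda>s. euclideanreal) UNIV) (PiE UNIV I)"
    by (subst compactin_PiE) (auto simp: I_def)
  then have "compact (PiE UNIV I)"
    by (simp add: euclidean_product_topology)
  moreover have "PiE UNIV I \<subseteq> vecs k"
    by (auto simp: PiE_UNIV_domain mem_vecs_iff I_def Pi_iff dest: spec)
       (metis leD singletonD)
  moreover have "x \<omega> i j \<in> PiE UNIV I" if "\<omega> \<in> D" for \<omega> i j
    using assms(2)[OF that, of i j] B[OF that, of i j]
    by (auto simp: PiE_UNIV_domain mem_vecs_iff I_def abs_le_iff) (use B[OF that, of i j] in \<open>metis abs_le_iff minus_le_iff\<close>)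
  ultimately show ?thesis
    by (intro exI[of _ "PiE UNIV I"] conjI ballI allI)
qed

text \<open>Coordinates separate points and are approximable by assumption. Three arguments are what
  a message takes: two node features and an edge feature.\<close>

lemma approximable_continuous_vecs:
  fixes x y z :: "'w \<Rightarrow> 'n \<Rightarrow> 'n \<Rightarrow> vec"
  assumes x: "\<And>s. approximable (\<lambda>\<omega> i j. x \<omega> i j s)" "\<And>\<omega> i j. \<omega> \<in> D \<Longrightarrow> x \<omega> i j \<in> vecs k1"
    and y: "\<And>s. approximable (\<lambda>\<omega> i j. y \<omega> i j s)" "\<And>\<omega> i j. \<omega> \<in> D \<Longrightarrow> y \<omega> i j \<in> vecs k2"
    and z: "\<And>s. approximable (\<lambda>\<omega> i j. z \<omega> i j s)" "\<And>\<omega> i j. \<omega> \<in> D \<Longrightarrow> z \<omega> i j \<in> vecs k3"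
    and \<phi>: "continuous_on (vecs k1 \<times> vecs k2 \<times> vecs k3) \<phi>"
  shows "approximable (\<lambda>\<omega> i j. \<phi> (x \<omega> i j, y \<omega> i j, z \<omega> i j))"
proof -
  obtain S1 where S1: "compact S1" "S1 \<subseteq> vecs k1" "\<And>\<omega> i j. \<omega> \<in> D \<Longrightarrow> x \<omega> i j \<in> S1"
    using approximable_compact_range[OF x] by blast
  obtain S2 where S2: "compact S2" "S2 \<subseteq> vecs k2" "\<And>\<omega> i j. \<omega> \<in> D \<Longrightarrow> y \<omega> i j \<in> S2"
    using approximable_compact_range[OF y] by blast
  obtain S3 where S3: "compact S3" "S3 \<subseteq> vecs k3" "\<And>\<omega> i j. \<omega> \<in> D \<Longrightarrow> z \<omega> i j \<in> S3"
    using approximable_compact_range[OF z] by blast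
  let ?S = "S1 \<times> S2 \<times> S3"
  show ?thesis
  proof (rule approximable_continuous[where S = ?S and \<phi> = \<phi> and
        P = "\<lambda>\<omega> i j. (x \<omega> i j, y \<omega> i j, z \<omega> i j)"])
    show "compact ?S"
      by (intro compact_Times S1 S2 S3)
    show "continuous_on ?S \<phi>"
      using \<phi> by (rule continuous_on_subset) (intro Sigma_mono S1 S2 S3)
    show "(x \<omega> i j, y \<omega> i j, z \<omega> i j) \<in> ?S" if "\<omega> \<in> D" for \<omega> i j
      using S1(3) S2(3) S3(3) that by simp
    fix p q :: "vec \<times> vec \<times> vec" assume "p \<noteq> q"
    then have "(\<exists>s. fst p s \<noteq> fst q s) \<or> (\<exists>s. fst (snd p) s \<noteq> fst (snd q) s) \<or>
        (\<exists>s. snd (snd p) s \<noteq> snd (snd q) s)"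
      by (auto simp: prod_eq_iff fun_eq_iff)
    then consider s where "fst p s \<noteq> fst q s" | s where "fst (snd p) s \<noteq> fst (snd q) s"
      | s where "snd (snd p) s \<noteq> snd (snd q) s"
      by blast
    then show "\<exists>f. continuous_on ?S f \<and> approximable (\<lambda>\<omega> i j. f (x \<omega> i j, y \<omega> i j, z \<omega> i j)) \<and> f p \<noteq> f q"
    proof cases
      case 1
      moreover have "continuous_on ?S (\<lambda>p. fst p s)"
        by (rule continuous_on_product_then_coordinatewise) (intro continuous_intros)
      ultimately show ?thesis
        using x(1)[of s] by (intro exI[of _ "\<lambda>p. fst p s"]) simp
    next
      case 2
      moreover have "continuous_on ?S (\<lambda>p. fst (snd p) s)"
        by (rule continuous_on_product_then_coordinatewise) (intro continuous_intros)
      ultimately show ?thesis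
        using y(1)[of s] by (intro exI[of _ "\<lambda>p. fst (snd p) s"]) simp
    next
      case 3
      moreover have "continuous_on ?S (\<lambda>p. snd (snd p) s)"
        by (rule continuous_on_product_then_coordinatewise) (intro continuous_intros)
      ultimately show ?thesis
        using z(1)[of s] by (intro exI[of _ "\<lambda>p. snd (snd p) s"]) simp
    qed
  qed
qed

text \<open>Stacking outputs is exact, so one \<epsilon> serves all channels. Counting by the last
  index \<open>k\<close> lets the induction start from a one-channel network.\<close>

lemma tensor_approximation:
  assumes g: "\<And>s. s \<le> k \<Longrightarrow> approximable (\<lambda>\<omega> i j. G \<omega> i j s)" and \<epsilon>: "\<epsilon> > 0"
  shows "\<exists>F. equivariant_network c (Suc k) F \<and>
    (\<forall>\<omega>\<in>D. \<forall>i j. \<forall>s\<le>k. \<bar>F (enc \<omega>) i j s - G \<omega> i j s\<bar> \<le> \<epsilon>)"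
  using g
proof (induction k)
  case 0
  then show ?case
    using approximable_network[OF 0[OF order_refl] \<epsilon>] by simp
next
  case (Suc k)
  have "\<exists>F. equivariant_network c (Suc k) F \<and>
      (\<forall>\<omega>\<in>D. \<forall>i j. \<forall>s\<le>k. \<bar>F (enc \<omega>) i j s - G \<omega> i j s\<bar> \<le> \<epsilon>)"
    using Suc.prems by (intro Suc.IH) simp
  then obtain F where F: "equivariant_network c (Suc k) F"
    "\<And>\<omega> i j s. \<omega> \<in> D \<Longrightarrow> s \<le> k \<Longrightarrow> \<bar>F (enc \<omega>) i j s - G \<omega> i j s\<bar> \<le> \<epsilon>"
    by blast
  obtain F' where F': "equivariant_network c 1 F'"
    "\<And>\<omega> i j. \<omega> \<in> D \<Longrightarrow> \<bar>F' (enc \<omega>) i j 0 - G \<omega> i j (Suc k)\<bar> \<le> \<epsilon>"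
    using approximable_network[OF Suc.prems[OF order_refl] \<epsilon>] by blast
  obtain H where H: "equivariant_network c (Suc k + 1) H"
    "\<And>X. X \<in> tensors c \<Longrightarrow> H X = hcat (Suc k) (F X) (F' X)"
    using equivariant_network_hcat[OF F(1) F'(1)] by blast
  have "\<bar>H (enc \<omega>) i j s - G \<omega> i j s\<bar> \<le> \<epsilon>" if "\<omega> \<in> D" "s \<le> Suc k" for \<omega> i j s
    using F(2)[OF that(1), of s i j] F'(2)[OF that(1), of i j] that H(2)[OF enc_in_tensors[OF that(1)]]
    by (cases "s = Suc k") (auto simp: hcat_def)
  then show ?case
    using H(1) by auto
qed

end

subsection \<open>Message passing\<close>

text \<open>Bridge from \<open>continuous_map\<close> between abstract topologies to
  \<open>continuous_on\<close>, the form in which Stone-Weierstrass is applied.\<close>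

lemma Euclidean_space_eq_vecs: "Euclidean_space k = top_of_set (vecs k)"
  by (simp add: Euclidean_space_def euclidean_product_topology vecs_def topspace_Euclidean_space)

lemma continuous_map_Euclidean_spaceD:
  assumes "continuous_map (top_of_set A) (Euclidean_space k) f"
  shows "continuous_on A (\<lambda>x. f x s)" and "x \<in> A \<Longrightarrow> f x \<in> vecs k"
  using assms
  by (auto simp: Euclidean_space_eq_vecs continuous_map_in_subtopology
      intro: continuous_on_product_then_coordinatewise)

text \<open>\<open>c > 0\<close> makes the set of entries nonempty, and its description as an image
  makes it finite, as \<open>Max\<close> requires.\<close>

lemma max_norm_leI:
  fixes X :: "'n::finite tensor"
  assumes "c > 0" "\<And>i j s. s < c \<Longrightarrow> \<bar>X i j s\<bar> \<le> e"
  shows "max_norm c X \<le> e"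
proof -
  have "{\<bar>X i j s\<bar> | i j s. s < c} = (\<lambda>(i, j, s). \<bar>X i j s\<bar>) ` (UNIV \<times> UNIV \<times> {..<c})"
    by force
  then show ?thesis
    using assms unfolding max_norm_def by (subst Max_le_iff) auto
qed

text \<open>A node feature is represented by the matrix whose (i, j) entry is the feature of i. Row
  sums have this form already, so the update gives node features in the same representation and the
  statement can be iterated.\<close>

lemma (in approximation) approximable_message_passing:
  fixes a :: "'w \<Rightarrow> 'n \<Rightarrow> 'n \<Rightarrow> real" and e :: "'w \<Rightarrow> 'n tensor" and h :: "'w \<Rightarrow> 'n \<Rightarrow> vec"
  assumes a: "approximable a" "\<And>\<omega>. \<omega> \<in> D \<Longrightarrow> adjacency_matrix (a \<omega>)"
    and e: "\<And>s. approximable (\<lambda>\<omega> i j. e \<omega> i j s)" "\<And>\<omega> i j. \<omega> \<in> D \<Longrightarrow> e \<omega> i j \<in> vecs l"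
    and h: "\<And>s. approximable (\<lambda>\<omega> i j. h \<omega> i s)" "\<And>\<omega> i. \<omega> \<in> D \<Longrightarrow> h \<omega> i \<in> vecs k"
    and M: "continuous_map
      (prod_topology (Euclidean_space k) (prod_topology (Euclidean_space k) (Euclidean_space l)))
      (Euclidean_space m) (\<lambda>(x, y, e). M x y e)"
    and U: "continuous_map (prod_topology (Euclidean_space k) (Euclidean_space m))
      (Euclidean_space k') (\<lambda>(x, m). U x m)"
  defines "h' \<equiv> \<lambda>\<omega> i. U (h \<omega> i) (\<lambda>s. \<Sum>v\<in>neighbours (a \<omega>) i. M (h \<omega> i) (h \<omega> v) (e \<omega> i v) s)"
  shows "approximable (\<lambda>\<omega> i j. h' \<omega> i s)" and "\<omega> \<in> D \<Longrightarrow> h' \<omega> i \<in> vecs k'"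
proof -
  define msg where "msg = (\<lambda>\<omega> i s. \<Sum>v\<in>neighbours (a \<omega>) i. M (h \<omega> i) (h \<omega> v) (e \<omega> i v) s)"
  have h'_eq: "h' \<omega> i = U (h \<omega> i) (msg \<omega> i)" for \<omega> i
    by (simp add: h'_def msg_def)
  have M': "continuous_map (top_of_set (vecs k \<times> vecs k \<times> vecs l)) (Euclidean_space m) (\<lambda>(x, y, e). M x y e)"
    and U': "continuous_map (top_of_set (vecs k \<times> vecs m)) (Euclidean_space k') (\<lambda>(x, m). U x m)"
    using M U by (simp_all add: Euclidean_space_eq_vecs)
  have Mcont: "continuous_on (vecs k \<times> vecs k \<times> vecs l) (\<lambda>(x, y, e). M x y e s)" for s
    using continuous_map_Euclidean_spaceD(1)[OF M', of s] by (simp add: case_prod_unfold)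
  have Mvecs: "M x y z \<in> vecs m" if "x \<in> vecs k" "y \<in> vecs k" "z \<in> vecs l" for x y z
    using continuous_map_Euclidean_spaceD(2)[OF M', of "(x, y, z)"] that by simp
  have Ucont: "continuous_on (vecs k \<times> vecs m) (\<lambda>(x, y). U x y s)" for s
    using continuous_map_Euclidean_spaceD(1)[OF U', of s] by (simp add: case_prod_unfold)
  have Uvecs: "U x y \<in> vecs k'" if "x \<in> vecs k" "y \<in> vecs m" for x y
    using continuous_map_Euclidean_spaceD(2)[OF U', of "(x, y)"] that by simp
  \<comment> \<open>A message at (i, j) also needs the feature of j, which is read off at the
    diagonal entry (j, j).\<close>
  have hcol: "approximable (\<lambda>\<omega> i j. h \<omega> j s)" for s
    using approximable_operator[OF equivariant_operator_diag_column h(1)] .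
  have msg: "approximable (\<lambda>\<omega> i j. msg \<omega> i s)" for s
  proof -
    have "approximable (\<lambda>\<omega> i j. M (h \<omega> i) (h \<omega> j) (e \<omega> i j) s)"
      using approximable_continuous_vecs[OF h(1) _ hcol _ e Mcont] h(2) by simp
    \<comment> \<open>The neighbourhood depends on the input, so no fixed linear operator sums over
      it. Multiplying by the 0/1 entry of \<open>a\<close> masks the other nodes, and the full row
      sum becomes the sum over neighbours.\<close>
    from approximable_operator[OF equivariant_operator_row_sum approximable_mult[OF a(1) this]]
    show ?thesis
    proof (rule approximable_cong)
      fix \<omega> i assume \<omega>: "\<omega> \<in> D"
      have "a \<omega> i v = (if v \<in> neighbours (a \<omega>) i then 1 else 0)" for v
        using a(2)[OF \<omega>] by (auto simp: adjacency_matrix_def neighbours_def)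
      then show "(\<Sum>v\<in>UNIV. a \<omega> i v * M (h \<omega> i) (h \<omega> v) (e \<omega> i v) s) = msg \<omega> i s"
        by (simp add: msg_def sum.If_cases if_distrib[of "\<lambda>x. x * _"] cong: if_cong)
    qed
  qed
  have msg_vecs: "msg \<omega> i \<in> vecs m" if "\<omega> \<in> D" for \<omega> i
    using Mvecs[OF h(2) h(2) e(2), OF that that that]
    by (auto simp: msg_def mem_vecs_iff intro: sum.neutral)
  \<comment> \<open>\<open>U\<close> has two arguments; the third slot is filled with the zero
    vector, the only element of \<open>vecs 0\<close>.\<close>
  have "continuous_on (vecs k \<times> vecs m \<times> vecs 0) ((\<lambda>(x, y). U x y s) \<circ> (\<lambda>p. (fst p, fst (snd p))))"
    by (intro continuous_on_compose continuous_on_subset[OF Ucont] continuous_intros) auto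
  from approximable_continuous_vecs[where z = "\<lambda>\<omega> i j s. 0", OF h(1) _ msg _ _ _ this]
  show "approximable (\<lambda>\<omega> i j. h' \<omega> i s)"
    using h(2) msg_vecs by (simp add: h'_eq approximable_const mem_vecs_iff[of _ 0])
  show "h' \<omega> i \<in> vecs k'" if "\<omega> \<in> D"
    using Uvecs h(2) msg_vecs that by (simp add: h'_eq)
qed

text \<open>The sum of absolute values over the finite index set is one continuous function
  dominating every member of the family.\<close>

lemma compact_imp_uniformly_bounded:
  fixes f :: "'i::finite \<Rightarrow> 'a::topological_space \<Rightarrow> real"
  assumes "compact K" "\<And>i. continuous_on K (f i)"
  shows "\<exists>B. \<forall>x\<in>K. \<forall>i. \<bar>f i x\<bar> \<le> B"
proof -
  let ?g = "\<lambda>x. \<Sum>i\<in>UNIV. \<bar>f i x\<bar>"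
  have "continuous_on K ?g"
    using assms(2) by (intro continuous_on_sum continuous_on_rabs)
  then have "bounded (?g ` K)"
    using assms(1) by (intro compact_imp_bounded compact_continuous_image)
  then obtain B where "\<forall>y\<in>?g ` K. \<bar>y\<bar> \<le> B"
    unfolding bounded_real by blast
  then have B: "\<bar>?g x\<bar> \<le> B" if "x \<in> K" for x
    using that by (rule bspec[OF _ imageI])
  have "\<bar>f i x\<bar> \<le> B" if "x \<in> K" for i x
  proof -
    have "\<bar>f i x\<bar> \<le> ?g x"
      by (rule member_le_sum) auto
    then show ?thesis
      using B[OF that] by linarith
  qed
  then show ?thesis by blast
qed

theorem corollary1:
  fixes l T :: nat
    and d d' :: "nat \<Rightarrow> nat"
    and M :: "nat \<Rightarrow> vec \<Rightarrow> vec \<Rightarrow> vec \<Rightarrow> vec"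
    and U :: "nat \<Rightarrow> vec \<Rightarrow> vec \<Rightarrow> vec"
    and K :: "(('n::finite \<Rightarrow> vec) \<times> 'n tensor) set"
    and \<epsilon> :: real
  assumes "l \<ge> 1" and "T \<ge> 1"
    and "\<And>t. t \<le> T \<Longrightarrow> d t \<ge> 1"
    and "\<And>t. t < T \<Longrightarrow> d' t \<ge> 1"
    and "\<And>t. t < T \<Longrightarrow>
           continuous_map
             (prod_topology (Euclidean_space (d t))
               (prod_topology (Euclidean_space (d t)) (Euclidean_space l)))
             (Euclidean_space (d' t))
             (\<lambda>(x, y, e). M t x y e)"
    and "\<And>t. t < T \<Longrightarrow>
           continuous_map
             (prod_topology (Euclidean_space (d t)) (Euclidean_space (d' t)))
             (Euclidean_space (d (Suc t)))
             (\<lambda>(x, m). U t x m)"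
    and "K \<subseteq> node_features (d 0) \<times> tensors l" and "compact K"
    and "\<epsilon> > 0"
  shows "\<exists>F :: 'n tensor \<Rightarrow> 'n tensor.
           equivariant_network (1 + l + d 0) (1 + l + d T) F \<and>
           (\<forall>(H0, E)\<in>K. \<forall>A. adjacency_matrix A \<longrightarrow>
              max_norm (1 + l + d T)
                (\<lambda>i j s. F (encoding l A E H0) i j s -
                         encoding l A E (mpnn M U A E H0 T) i j s) \<le> \<epsilon>)"
proof -
  \<comment> \<open>The adjacency matrix is part of the input, so a single network serves all graphs
    at once.\<close>
  define D :: "(('n \<Rightarrow> 'n \<Rightarrow> real) \<times> ('n \<Rightarrow> vec) \<times> 'n tensor) set" where
    "D = {A. adjacency_matrix A} \<times> K"
  define enc where "enc = (\<lambda>(A, H0, E). encoding l A E H0 :: 'n tensor)"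
  define h where "h = (\<lambda>t (A :: 'n \<Rightarrow> 'n \<Rightarrow> real, H0, E). mpnn M U A E H0 t)"
  have D: "adjacency_matrix A" "(H0, E) \<in> K" "H0 \<in> node_features (d 0)" "E \<in> tensors l"
    if "(A, H0, E) \<in> D" for A H0 E
    using that assms(7) by (auto simp: D_def)
  interpret approximation "1 + l + d 0" D enc
  proof
    fix \<omega> assume "\<omega> \<in> D"
    then show "enc \<omega> \<in> tensors (1 + l + d 0)"
      using D by (cases \<omega>) (auto simp: enc_def encoding_def mem_tensors_iff node_features_def mem_vecs_iff)
  qed
  have channel: "approximable (\<lambda>\<omega> i j. enc \<omega> i j s)" for s
  proof -
    \<comment> \<open>Compactness of \<open>K\<close> yields the entry bounds \<open>B\<close> and
      \<open>B'\<close>. Both hold for every \<open>s\<close>, subtraction on nat being truncated,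
      so their maximum with 1 bounds the channel in whichever case of \<open>encoding\<close> it
      falls.\<close>
    have "continuous_on K (\<lambda>x. snd x i j (s - 1))" for i j
      by (rule continuous_on_product_then_coordinatewise[OF continuous_on_product_then_coordinatewise[OF
            continuous_on_product_then_coordinatewise[OF continuous_on_snd[OF continuous_on_id]]]])
    then have "\<exists>B. \<forall>x\<in>K. \<forall>p. \<bar>snd x (fst p) (snd p) (s - 1)\<bar> \<le> B"
      by (intro compact_imp_uniformly_bounded[where f = "\<lambda>p x. snd x (fst p) (snd p) (s - 1)"] \<open>compact K\<close>)
    then obtain B where B: "\<And>x i j. x \<in> K \<Longrightarrow> \<bar>snd x i j (s - 1)\<bar> \<le> B"
      by (metis fst_conv snd_conv)
    have "continuous_on K (\<lambda>x. fst x i (s - (1 + l)))" for i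
      by (rule continuous_on_product_then_coordinatewise[OF
            continuous_on_product_then_coordinatewise[OF continuous_on_fst[OF continuous_on_id]]])
    then have "\<exists>B. \<forall>x\<in>K. \<forall>i. \<bar>fst x i (s - (1 + l))\<bar> \<le> B"
      by (intro compact_imp_uniformly_bounded[where f = "\<lambda>i x. fst x i (s - (1 + l))"] \<open>compact K\<close>)
    then obtain B' where B': "\<And>x i. x \<in> K \<Longrightarrow> \<bar>fst x i (s - (1 + l))\<bar> \<le> B'"
      by blast
    show ?thesis
    proof (rule approximable_channel)
      fix \<omega> i j assume \<omega>: "\<omega> \<in> D"
      obtain A H0 E where "\<omega> = (A, H0, E)"
        by (cases \<omega>)
      moreover have "A i j \<in> {0, 1}"
        using D(1)[of A H0 E] \<omega> calculation unfolding adjacency_matrix_def by blast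
      then have "\<bar>A i j\<bar> \<le> 1"
        by auto
      ultimately show "\<bar>enc \<omega> i j s\<bar> \<le> max 1 (max B B')"
        using B[of "(H0, E)" i j] B'[of "(H0, E)" i] D(2)[of A H0 E] \<omega>
        by (auto simp: enc_def encoding_def le_max_iff_disj)
    qed
  qed
  have A: "approximable (\<lambda>(A, H0, E) i j. A i j)"
    using channel[of 0] by (rule approximable_cong) (auto simp: enc_def encoding_def)
  have E: "approximable (\<lambda>(A, H0, E) i j. E i j s)" for s
  proof (cases "s < l")
    case True
    show ?thesis
      using channel[of "1 + s"] by (rule approximable_cong) (use True in \<open>auto simp: enc_def encoding_def\<close>)
  next
    case False
    \<comment> \<open>Vectors are infinite sequences, so the padding coordinates must be
      approximable too; they vanish.\<close>
    show ?thesis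
      using approximable_const[of 0] by (rule approximable_cong) (use False D(4) in \<open>auto simp: mem_tensors_iff\<close>)
  qed
  have H: "(\<forall>s. approximable (\<lambda>\<omega> i j. h t \<omega> i s)) \<and> (\<forall>\<omega>\<in>D. \<forall>i. h t \<omega> i \<in> vecs (d t))" if "t \<le> T" for t
    using that
  proof (induction t)
    case 0
    \<comment> \<open>The encoding stores node features on the diagonal; copying the entry (i, i)
      along row i gives the representation used for message passing.\<close>
    have "approximable (\<lambda>\<omega> i j. h 0 \<omega> i s)" for s
      using approximable_operator[OF equivariant_operator_diag_row channel[of "1 + l + s"]]
      by (rule approximable_cong) (auto simp: enc_def encoding_def h_def)
    then show ?case
      using D(3) by (auto simp: h_def node_features_def)
  next
    case (Suc t)
    then have t: "t < T" by simp
    let ?a = "\<lambda>(A, H0, E). A" and ?e = "\<lambda>(A, H0, E). E"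
    have eq: "h (Suc t) = (\<lambda>\<omega> i. U t (h t \<omega> i)
        (\<lambda>s. \<Sum>v\<in>neighbours (?a \<omega>) i. M t (h t \<omega> i) (h t \<omega> v) (?e \<omega> i v) s))"
      by (auto simp: h_def fun_eq_iff Let_def)
    have a': "approximable ?a" "\<And>\<omega>. \<omega> \<in> D \<Longrightarrow> adjacency_matrix (?a \<omega>)"
      using A D(1) by (auto simp: case_prod_unfold)
    have e': "\<And>s. approximable (\<lambda>\<omega> i j. ?e \<omega> i j s)" "\<And>\<omega> i j. \<omega> \<in> D \<Longrightarrow> ?e \<omega> i j \<in> vecs l"
      using E D(4) by (auto simp: case_prod_unfold tensors_def)
    have h': "\<And>s. approximable (\<lambda>\<omega> i j. h t \<omega> i s)" "\<And>\<omega> i. \<omega> \<in> D \<Longrightarrow> h t \<omega> i \<in> vecs (d t)"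
      using Suc by auto
    show ?case
      unfolding eq
      using approximable_message_passing[OF a' e' h' assms(5)[OF t] assms(6)[OF t]] by blast
  qed
  have "approximable (\<lambda>(A, H0, E) i j. encoding l A E (h T (A, H0, E)) i j s)" for s
  proof -
    consider "s = 0" | "0 < s" "s < 1 + l" | "1 + l \<le> s"
      by linarith
    then show ?thesis
    proof cases
      case 1
      show ?thesis
        using A by (rule approximable_cong) (use 1 in \<open>auto simp: encoding_def\<close>)
    next
      case 2
      show ?thesis
        using E[of "s - 1"] by (rule approximable_cong) (use 2 in \<open>auto simp: encoding_def\<close>)
    next
      case 3
      \<comment> \<open>Back from the representation along rows to the diagonal one demanded by the
        encoding.\<close>
      have "approximable (\<lambda>\<omega> i j. if i = j then h T \<omega> i (s - (1 + l)) else 0)"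
        using H[of T] by (intro approximable_operator[OF equivariant_operator_diag_part]) auto
      then show ?thesis
        by (rule approximable_cong) (use 3 in \<open>auto simp: encoding_def\<close>)
    qed
  qed
  then have "approximable (\<lambda>\<omega> i j. (\<lambda>(A, H0, E). encoding l A E (h T (A, H0, E))) \<omega> i j s)" for s
    by (simp add: case_prod_unfold)
  \<comment> \<open>The last channel index l + d T corresponds to 1 + l + d T output
    channels.\<close>
  from tensor_approximation[where G = "\<lambda>(A, H0, E). encoding l A E (h T (A, H0, E))"
      and k = "l + d T", OF this \<open>\<epsilon> > 0\<close>]
  obtain F where F: "equivariant_network (1 + l + d 0) (Suc (l + d T)) F"
    and Fapprox: "\<forall>\<omega>\<in>D. \<forall>i j. \<forall>s\<le>l + d T. \<bar>F (enc \<omega>) i j s -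
      (case \<omega> of (A, H0, E) \<Rightarrow> encoding l A E (h T (A, H0, E))) i j s\<bar> \<le> \<epsilon>"
    by blast
  have "max_norm (1 + l + d T) (\<lambda>i j s. F (encoding l A E H0) i j s -
      encoding l A E (mpnn M U A E H0 T) i j s) \<le> \<epsilon>"
    if "(H0, E) \<in> K" "adjacency_matrix A" for H0 E A
    using bspec[OF Fapprox, of "(A, H0, E)"] that
    by (intro max_norm_leI) (auto simp: D_def enc_def h_def)
  then show ?thesis
    using F by (intro exI[of _ F]) auto
qed

end
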